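(* Let $m\ge 2$ and $n\ge 2$ be integers. The AWG-based WDM shuffle-exchange network $\mathcal{S}(m,n)$ has the self-routing property: for every input channel $S=\underline{s_n}\,\underline{s_{n-1}}\cdots\underline{s_1}$ and every output channel $D=\underline{d_n}\,\underline{d_{n-1}}\cdots\underline{d_1}$ of $\mathcal{S}(m,n)$, the path from $S$ to $D$ is uniquely determined by $S$ and $D$. Explicitly, the path $X_0\to Y_0\to X_1\to Y_1\to\cdots\to X_{n-1}\to Y_{n-1}\to X_n$ with $X_0=S$ and $X_n=D$ is given as follows. For $0\le k\le n-1$, $$X_k=\underline{s_{n-k}}\cdots\underline{s_1}\,\underline{d_n}\cdots\underline{d_{n-k+1}},\qquad Y_k=\underline{s_{n-k-1}}\cdots\underline{s_1}\,\underline{d_n}\cdots\underline{d_{n-k+1}}\,\underline{s_{n-k}},$$ and the request uses wavelength $\lambda_{i_k}$ in shuffle stage $k$ and $\lambda_{i_n}$ in the output stage, where $$i_0=[s_n+s_1]_m,\qquad i_k=[s_{n-k}+d_{n-k+1}]_m\ (1\le k\le n-1),\qquad i_n=[d_n+d_1]_m .$$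
   Context: Notation: $[X]_m$ denotes $X \bmod m$, taken in $\{0,\dots,m-1\}$. Strings $\underline{x_n}\cdots\underline{x_1}$ have digits in $\{0,\dots,m-1\}$. An $m\times m$ AWG (arrayed waveguide grating) is a passive wavelength router with inputs and outputs $0,\dots,m-1$ and wavelengths $\lambda_0,\dots,\lambda_{m-1}$. A signal entering input $p$ on $\lambda_i$ leaves at output $q'=[i-p]_m$ on $\lambda_i$. The AWG-based shuffle network $\mathcal{W}(m,m^{n-1})$ is built from $m^{n-2}$ AWGs of size $m\times m$, numbered by $a\in\{0,\dots,m^{n-2}-1\}$. It has input ports $(p,a)$, $0\le p\le m-1$, where port $(p,a)$ is linked to input $p$ of AWG $a$. It has output ports $(a,q')$, $0\le q'\le m-1$, where port $(a,q')$ is linked to output $q'$ of AWG $a$. Every port carries the wavelengths $\lambda_0,\dots,\lambda_{m-1}$. An input port $(p,a)$ has the address $\underline{x_n}\,\underline{x_{n-1}}\cdots\underline{x_2}$, where $x_n=p$ and $\underline{x_{n-1}}\cdots\underline{x_2}$ is the $m$-ary representation of $a$. An input channel (input port, wavelength) $(\underline{x_n}\cdots\underline{x_2},\lambda_i)$ has the field address $\underline{x_n}\cdots\underline{x_2}\,\underline{x_1}$ with $x_1=[i-x_n]_m$. An output port $(a,q')$ has the address $\underline{y_n}\cdots\underline{y_2}$, where $\underline{y_n}\cdots\underline{y_3}$ is the $m$-ary representation of $a$ and $y_2=q'$. An output channel $(\underline{y_n}\cdots\underline{y_2},\lambda_i)$ has the field address $\underline{y_n}\cdots\underline{y_2}\,\underline{y_1}$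 with $y_1=[i-y_2]_m$. The network $\mathcal{S}(m,n)$ is the cascade of $n$ copies $\mathcal{W}_0,\dots,\mathcal{W}_{n-1}$ of $\mathcal{W}(m,m^{n-1})$ (shuffle stages), in which every output port of every copy is attached to an $m\times m$ TWC-module. The TWC-module attached to output port $\underline{y_n}\cdots\underline{y_2}$ of $\mathcal{W}_k$ leads to the input port of $\mathcal{W}_{k+1}$ with the same address $\underline{y_n}\cdots\underline{y_2}$ if $k<n-1$, and to the output port of $\mathcal{S}(m,n)$ with that address (in the output stage) if $k=n-1$. A TWC-module (tunable wavelength converters) can convert each wavelength on its incoming fiber to any wavelength $\lambda_0,\dots,\lambda_{m-1}$ on its outgoing fiber, like an $m\times m$ crossbar. The input channels of $\mathcal{S}(m,n)$ are those of $\mathcal{W}_0$, with the same field addresses. The output channels of $\mathcal{S}(m,n)$ are addressed in the same way as the input channels of a shuffle stage: $(\underline{d_n}\cdots\underline{d_2},\lambda_i)$ has field address $\underline{d_n}\cdots\underline{d_2}\,\underline{d_1}$ with $d_1=[i-d_n]_m$. A path from $S$ to $D$ is a sequence of channels $X_0=S,Y_0,X_1,Y_1,\dots,X_{n-1},Y_{n-1},X_n=D$ such that $X_k$ and $Y_k$ are an input channel and an output channel of $\mathcal{W}_k$ connected through $\mathcal{W}_k$ (for $0\le k\le n-1$), and $X_{k+1}$ is a channel (of $\mathcal{W}_{k+1}$, or of the output stage if $k=n-1$) at the port reached through the TWC-module attached to the output port of $Y_k$. *)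

theory Defs
  imports Main
begin

text \<open>A string \<open>x\<^sub>h \<dots> x\<^sub>l\<close> is a list with its most significant digit first; it is empty
  if \<open>h < l\<close>. The digits of a string are indexed as \<open>x n, \<dots>, x 1\<close>, so the index 0 is not used.\<close>

definition digits :: "(nat \<Rightarrow> nat) \<Rightarrow> nat \<Rightarrow> nat \<Rightarrow> nat list" where
  "digits x h l = map x (rev [l..<Suc h])"

definition residue :: "nat \<Rightarrow> int \<Rightarrow> nat" where
  "residue m X = nat (X mod int m)"

text \<open>The \<open>m\<close>-ary representation of \<open>a\<close>, padded to \<open>l\<close> digits.\<close>

definition m_ary :: "nat \<Rightarrow> nat \<Rightarrow> nat \<Rightarrow> nat list" where
  "m_ary m l a = map (\<lambda>j. a div m ^ j mod m) (rev [0..<l])"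

text \<open>An input port is a pair \<open>(p, a)\<close> and an output port a pair \<open>(a, q)\<close>, where \<open>a\<close> is the number
  of an AWG; a channel is a pair of a port and the index \<open>i\<close> of a wavelength \<open>\<lambda>\<^sub>i\<close>.\<close>

type_synonym in_port = "nat \<times> nat"
type_synonym out_port = "nat \<times> nat"
type_synonym in_channel = "in_port \<times> nat"
type_synonym out_channel = "out_port \<times> nat"

definition awg_output :: "nat \<Rightarrow> nat \<Rightarrow> nat \<Rightarrow> nat" where
  "awg_output m p i = residue m (int i - int p)"


subsection \<open>The AWG-based shuffle network \<open>W(m, m^(n-1))\<close>\<close>

definition in_ports :: "nat \<Rightarrow> nat \<Rightarrow> in_port set" where
  "in_ports m n = {..<m} \<times> {..<m ^ (n - 2)}"

definition out_ports :: "nat \<Rightarrow> nat \<Rightarrow> out_port set" where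
  "out_ports m n = {..<m ^ (n - 2)} \<times> {..<m}"

definition in_channels :: "nat \<Rightarrow> nat \<Rightarrow> in_channel set" where
  "in_channels m n = in_ports m n \<times> {..<m}"

definition out_channels :: "nat \<Rightarrow> nat \<Rightarrow> out_channel set" where
  "out_channels m n = out_ports m n \<times> {..<m}"

fun in_port_address :: "nat \<Rightarrow> nat \<Rightarrow> in_port \<Rightarrow> nat list" where
  "in_port_address m n (p, a) = p # m_ary m (n - 2) a"

fun out_port_address :: "nat \<Rightarrow> nat \<Rightarrow> out_port \<Rightarrow> nat list" where
  "out_port_address m n (a, q) = m_ary m (n - 2) a @ [q]"

fun in_field_address :: "nat \<Rightarrow> nat \<Rightarrow> in_channel \<Rightarrow> nat list" where
  "in_field_address m n ((p, a), i) = in_port_address m n (p, a) @ [residue m (int i - int p)]"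

fun out_field_address :: "nat \<Rightarrow> nat \<Rightarrow> out_channel \<Rightarrow> nat list" where
  "out_field_address m n ((a, q), i) = out_port_address m n (a, q) @ [residue m (int i - int q)]"

fun shuffle_connected :: "nat \<Rightarrow> in_channel \<Rightarrow> out_channel \<Rightarrow> bool" where
  "shuffle_connected m ((p, a), i) ((a', q), j) \<longleftrightarrow> a' = a \<and> q = awg_output m p i \<and> j = i"


subsection \<open>The network \<open>S(m, n)\<close>\<close>

text \<open>The ports of the output stage carry the same addresses as the input ports of a shuffle stage
  and are named by the same pairs. A TWC-module imposes no relation between the incoming and
  the outgoing wavelength, so it relates ports only.\<close>

definition net_in_channels :: "nat \<Rightarrow> nat \<Rightarrow> in_channel set" where
  "net_in_channels m n = in_channels m n"

definition net_out_channels :: "nat \<Rightarrow> nat \<Rightarrow> in_channel set" where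
  "net_out_channels m n = in_channels m n"

definition twc_linked :: "nat \<Rightarrow> nat \<Rightarrow> out_port \<Rightarrow> in_port \<Rightarrow> bool" where
  "twc_linked m n u v \<longleftrightarrow> u \<in> out_ports m n \<and> v \<in> in_ports m n \<and>
     in_port_address m n v = out_port_address m n u"

text \<open>In a path \<open>(X, Y)\<close>, \<open>X ! k\<close> and \<open>Y ! k\<close> are channels of the \<open>k\<close>-th copy of the shuffle
  network for \<open>k < n\<close>, and \<open>X ! n\<close> is a channel of the output stage.\<close>

fun is_path :: "nat \<Rightarrow> nat \<Rightarrow> in_channel \<Rightarrow> in_channel \<Rightarrow>
    in_channel list \<times> out_channel list \<Rightarrow> bool" where
  "is_path m n S D (X, Y) \<longleftrightarrow>
     length X = n + 1 \<and> length Y = n \<and> X ! 0 = S \<and> X ! n = D \<and>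
     (\<forall>k<n. X ! k \<in> in_channels m n \<and> Y ! k \<in> out_channels m n \<and>
        shuffle_connected m (X ! k) (Y ! k)) \<and>
     (\<forall>k<n. X ! (k + 1) \<in> (if k + 1 < n then in_channels m n else net_out_channels m n) \<and>
        twc_linked m n (fst (Y ! k)) (fst (X ! (k + 1))))"

end

theory Submission
  imports Defs
begin

text \<open>A shuffle stage rotates the field address by one digit, and a TWC-module preserves all digits but
  the last. So along a path the address of \<open>X\<^sub>k\<^sub>+\<^sub>1\<close> is obtained from that of \<open>X\<^sub>k\<close> by dropping the first
  digit and appending an arbitrary one. Hence the addresses are the windows of length \<open>n\<close> of one string
  of length \<open>2n\<close>, whose halves are the addresses of \<open>S\<close> and \<open>D\<close>. Since field addresses name
  channels bijectively, this determines the path, and the wavelength of a channel is the sum of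
  the first and the last digit of its address.\<close>

section \<open>Words and m-ary digit strings\<close>

definition words :: "nat \<Rightarrow> nat \<Rightarrow> nat list set" where
  "words m l = {xs. set xs \<subseteq> {..<m} \<and> length xs = l}"

lemma card_words: "card (words m l) = m ^ l"
  unfolding words_def by (simp add: card_lists_length_eq)

text \<open>An injection between finite sets of equal size is onto, so no channel with a prescribed
  address has to be constructed.\<close>

lemma bij_betw_words:
  assumes "inj_on f A" and "f ` A \<subseteq> words m l" and "card A = m ^ l"
  shows "bij_betw f A (words m l)"
proof -
  have "finite (words m l)"
    unfolding words_def by (simp add: finite_lists_length_eq)
  then have "f ` A = words m l"
    using assms by (intro card_subset_eq) (auto simp: card_image card_words)
  with assms(1) show ?thesis by (simp add: bij_betw_def)
qed

lemma m_ary_Suc: "m_ary m (Suc l) a = m_ary m l (a div m) @ [a mod m]"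
proof -
  \<comment> \<open>Index 0 opens the range, so after reversal its digit comes last; the other
    exponents drop by one when \<open>a\<close> is divided by \<open>m\<close>.\<close>
  have "[0..<Suc l] = 0 # map Suc [0..<l]"
    by (simp add: upt_conv_Cons map_Suc_upt del: upt_Suc)
  then show ?thesis
    by (simp add: m_ary_def rev_map o_def div_mult2_eq del: upt_Suc)
qed

lemma length_m_ary [simp]: "length (m_ary m l a) = l"
  by (simp add: m_ary_def)

lemma set_m_ary_less: "x \<in> set (m_ary m l a) \<Longrightarrow> 0 < m \<Longrightarrow> x < m"
  by (auto simp: m_ary_def)

lemma m_ary_eqD:
  "m_ary m l a = m_ary m l b \<Longrightarrow> a < m ^ l \<Longrightarrow> b < m ^ l \<Longrightarrow> a = b"
proof (induction l arbitrary: a b)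
  case (Suc l)
  have "a div m = b div m"
    using Suc.prems by (intro Suc.IH) (auto simp: m_ary_Suc less_mult_imp_div_less mult.commute)
  moreover have "a mod m = b mod m"
    using Suc.prems by (simp add: m_ary_Suc)
  ultimately show ?case by (metis div_mult_mod_eq)
qed simp

section \<open>Residues and the AWG routing rule\<close>

lemma residue_less [simp]: "0 < m \<Longrightarrow> residue m X < m"
  by (simp add: residue_def nat_less_iff)

lemma int_residue: "0 < m \<Longrightarrow> int (residue m X) = X mod int m"
  by (simp add: residue_def)

text \<open>At a fixed wavelength the AWG acts as the involution p -> [i - p]. Hence the last digit
  of an output channel is the input index of its AWG.\<close>

lemma residue_diff_residue:
  assumes "p < m"
  shows "residue m (int i - int (residue m (int i - int p))) = p"
proof -
  have "int (residue m (int i - int (residue m (int i - int p)))) = int p"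
    using assms by (simp add: int_residue mod_diff_right_eq)
  then show ?thesis by simp
qed

text \<open>Recovers a wavelength from a port index and the last digit of the field address.\<close>

lemma add_residue_diff:
  assumes "i < m"
  shows "(p + residue m (int i - int p)) mod m = i"
proof -
  have "int ((p + residue m (int i - int p)) mod m) = int i"
    using assms by (simp add: zmod_int int_residue mod_add_right_eq)
  then show ?thesis by simp
qed

section \<open>Field addresses as bijections\<close>

lemma card_channels:
  assumes "2 \<le> n"
  shows "card (in_channels m n) = m ^ n" and "card (out_channels m n) = m ^ n"
proof -
  have "m ^ n = m * m ^ (n - 2) * m"
    using assms by (metis le_add_diff_inverse power2_eq_square power_add mult.assoc mult.commute)
  then show "card (in_channels m n) = m ^ n" and "card (out_channels m n) = m ^ n"
    by (simp_all add: in_channels_def in_ports_def out_channels_def out_ports_def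
        card_cartesian_product ac_simps)
qed

text \<open>The first digit gives the port index, the middle digits give the AWG number, and first
  plus last digit gives the wavelength; counting does the rest.\<close>

lemma bij_in_field_address:
  assumes "0 < m" and "2 \<le> n"
  shows "bij_betw (in_field_address m n) (in_channels m n) (words m n)"
proof (rule bij_betw_words)
  show "inj_on (in_field_address m n) (in_channels m n)"
  proof (rule inj_onI)
    fix X X'
    assume *: "X \<in> in_channels m n" "X' \<in> in_channels m n"
      "in_field_address m n X = in_field_address m n X'"
    obtain p a i p' a' i' where X: "X = ((p, a), i)" "X' = ((p', a'), i')"
      by (metis prod.exhaust)
    have "a = a'"
      using * X by (intro m_ary_eqD[of m "n - 2"]) (auto simp: in_channels_def in_ports_def)
    moreover have eq: "p = p'"
        "residue m (int i - int p) = residue m (int i' - int p')"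
      using * X by auto
    moreover have "i = i'"
    proof -
      have "i < m" "i' < m" using * X by (auto simp: in_channels_def)
      then show ?thesis using eq add_residue_diff by metis
    qed
    ultimately show "X = X'" using X by simp
  qed
  show "in_field_address m n ` in_channels m n \<subseteq> words m n"
    using assms by (auto intro: set_m_ary_less[OF _ assms(1)] simp: words_def in_channels_def in_ports_def)
  show "card (in_channels m n) = m ^ n"
    by (rule card_channels) fact
qed

text \<open>As for input channels, but the port index is now the last digit but one.\<close>

lemma bij_out_field_address:
  assumes "0 < m" and "2 \<le> n"
  shows "bij_betw (out_field_address m n) (out_channels m n) (words m n)"
proof (rule bij_betw_words)
  show "inj_on (out_field_address m n) (out_channels m n)"
  proof (rule inj_onI)
    fix Y Y'
    assume *: "Y \<in> out_channels m n" "Y' \<in> out_channels m n"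
      "out_field_address m n Y = out_field_address m n Y'"
    obtain q a i q' a' i' where Y: "Y = ((a, q), i)" "Y' = ((a', q'), i')"
      by (metis prod.exhaust)
    have "a = a'"
      using * Y by (intro m_ary_eqD[of m "n - 2"]) (auto simp: out_channels_def out_ports_def)
    moreover have eq: "q = q'"
        "residue m (int i - int q) = residue m (int i' - int q')"
      using * Y by auto
    moreover have "i = i'"
    proof -
      have "i < m" "i' < m" using * Y by (auto simp: out_channels_def)
      then show ?thesis using eq add_residue_diff by metis
    qed
    ultimately show "Y = Y'" using Y by simp
  qed
  show "out_field_address m n ` out_channels m n \<subseteq> words m n"
    using assms by (auto intro: set_m_ary_less[OF _ assms(1)] simp: words_def out_channels_def out_ports_def)
  show "card (out_channels m n) = m ^ n"
    by (rule card_channels) fact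
qed

section \<open>Effect of AWGs and TWC-modules on addresses\<close>

lemma length_in_field_address: "2 \<le> n \<Longrightarrow> length (in_field_address m n X) = n"
  by (cases "(m, n, X)" rule: in_field_address.cases) auto

lemma wavelength_in_channel:
  assumes "X \<in> in_channels m n"
  shows "snd X = (hd (in_field_address m n X) + last (in_field_address m n X)) mod m"
  using assms
  by (cases "(m, n, X)" rule: in_field_address.cases) (auto simp: in_channels_def add_residue_diff)

text \<open>The addresses read p, a, [i - p] and a, q, [i - q]. Routing sets q = [i - p], and the
  involution then turns [i - q] into p.\<close>

lemma shuffle_connected_iff_rotate1:
  assumes "X \<in> in_channels m n" and "Y \<in> out_channels m n"
  shows "shuffle_connected m X Y \<longleftrightarrow>
    out_field_address m n Y = rotate1 (in_field_address m n X)"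
proof -
  obtain p a i a' q j where XY: "X = ((p, a), i)" "Y = ((a', q), j)"
    by (metis prod.exhaust)
  have bounds: "p < m" "a < m ^ (n - 2)" "i < m" "a' < m ^ (n - 2)" "j < m"
    using assms XY by (auto simp: in_channels_def out_channels_def in_ports_def out_ports_def)
  show ?thesis
  proof
    assume "shuffle_connected m X Y"
    then show "out_field_address m n Y = rotate1 (in_field_address m n X)"
      using XY bounds by (simp add: awg_output_def residue_diff_residue)
  next
    assume "out_field_address m n Y = rotate1 (in_field_address m n X)"
    then have eq: "m_ary m (n - 2) a' = m_ary m (n - 2) a"
      "q = residue m (int i - int p)" "residue m (int j - int q) = p"
      using XY by auto
    \<comment> \<open>Both wavelengths equal the sum of the two port indices modulo
      \<open>m\<close>.\<close>
    have "j = (q + p) mod m"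
      using eq(3) add_residue_diff[of j m q] bounds by simp
    also have "\<dots> = i"
      using eq(2) add_residue_diff[of i m p] bounds by (simp add: add.commute)
    finally show "shuffle_connected m X Y"
      using XY eq bounds m_ary_eqD[of m "n - 2" a' a] by (simp add: awg_output_def)
  qed
qed

text \<open>Without its last digit a field address is the port address, and only ports are
  constrained by a TWC-module.\<close>

lemma twc_linked_iff_butlast:
  assumes "Y \<in> out_channels m n" and "X \<in> in_channels m n"
  shows "twc_linked m n (fst Y) (fst X) \<longleftrightarrow>
    butlast (in_field_address m n X) = butlast (out_field_address m n Y)"
  using assms
  by (cases "(m, n, X)" rule: in_field_address.cases;
      cases "(m, n, Y)" rule: out_field_address.cases)
    (auto simp: twc_linked_def in_channels_def out_channels_def butlast_append)

section \<open>Sliding windows over one string\<close>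

lemma butlast_rotate1: "butlast (rotate1 xs) = tl xs"
  by (cases xs) simp_all

text \<open>Consecutive windows overlap in all but one letter. Letters at positions below
  \<open>n\<close> propagate forward from \<open>x 0\<close>, the others backward from
  \<open>x n\<close>.\<close>

lemma sliding_windows:
  assumes len: "\<And>k. k \<le> n \<Longrightarrow> length (x k) = n"
    and slide: "\<And>k. k < n \<Longrightarrow> butlast (x (Suc k)) = tl (x k)"
    and first: "x 0 = map w [0..<n]" and last: "x n = map w [n..<n + n]"
    and "k \<le> n"
  shows "x k = map w [k..<k + n]"
proof -
  have shift: "x (Suc k) ! j = x k ! Suc j" if "k < n" "Suc j < n" for k j
    using that len[of k] len[of "Suc k"] slide[of k]
    by (metis Suc_leI diff_Suc_1 length_butlast less_Suc_eq_le less_diff_conv less_imp_le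
        nth_butlast nth_tl Suc_eq_plus1 length_tl)
  have fwd: "x k ! j = w (k + j)" if "k + j < n" for k j
    using that
  proof (induction k arbitrary: j)
    case 0
    then show ?case by (simp add: first)
  next
    case (Suc k)
    then show ?case using shift[of k j] Suc.IH[of "Suc j"] by simp
  qed
  have bwd: "x k ! j = w (k + j)" if "k \<le> n" "n \<le> k + j" "j < n" for k j
    using that
  proof (induction k arbitrary: j rule: inc_induct)
    case base
    then show ?case by (simp add: last)
  next
    case (step k)
    \<comment> \<open>Here \<open>j\<close> is positive because \<open>k < n \<le> k + j\<close>, so
      the letter also occurs in the next window, one place to the left.\<close>
    then obtain j' where "j = Suc j'" by (cases j) auto
    then show ?case using step shift[of k j'] by simp
  qed
  have "x k ! j = w (k + j)" if "j < n" for j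
    using fwd[of k j] bwd[of k j] \<open>k \<le> n\<close> that by linarith
  then show ?thesis
    using len[of k] \<open>k \<le> n\<close> by (intro nth_equalityI) auto
qed

section \<open>The route string and the characterization of paths\<close>

lemma length_digits [simp]: "length (digits x h l) = Suc h - l"
  by (simp add: digits_def del: upt_Suc)

lemma nth_digits: "j < Suc h - l \<Longrightarrow> digits x h l ! j = x (h - j)"
  by (simp add: digits_def rev_nth del: upt_Suc)

lemma digits_Cons: "0 < l \<Longrightarrow> l \<le> h \<Longrightarrow> digits x h l = x h # digits x (h - 1) l"
  by (cases h) (auto simp: digits_def)

text \<open>The string of length 2n formed by the digits of S followed by those of D. Positions
  count up from 0 while digit indices count down, hence the subtractions.\<close>

definition route :: "nat \<Rightarrow> (nat \<Rightarrow> nat) \<Rightarrow> (nat \<Rightarrow> nat) \<Rightarrow> nat \<Rightarrow> nat" where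
  "route n s d t = (if t < n then s (n - t) else d (2 * n - t))"

lemma route_window:
  assumes "k \<le> n"
  shows "map (route n s d) [k..<k + n] = digits s (n - k) 1 @ digits d n (n - k + 1)"
proof (rule nth_equalityI)
  fix j assume "j < length (map (route n s d) [k..<k + n])"
  then have "j < n" by simp
  \<comment> \<open>The first n - k letters of the window lie in the half of S, the remaining k in
    that of D.\<close>
  then have "j < n - k \<and> n - (k + j) = n - k - j \<or>
      \<not> j < n - k \<and> j - (n - k) < k \<and> 2 * n - (k + j) = n - (j - (n - k))"
    using assms by linarith
  with \<open>j < n\<close> assms show "map (route n s d) [k..<k + n] ! j =
      (digits s (n - k) 1 @ digits d n (n - k + 1)) ! j"
    by (auto simp: nth_append nth_digits route_def)
qed (use assms in simp)

text \<open>Replaces the links between neighbouring channels by a separate address condition on each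
  entry, so that paths can be counted entry by entry.\<close>

lemma is_path_iff_windows:
  assumes m: "0 < m" and n: "2 \<le> n"
    and S: "S \<in> in_channels m n" "in_field_address m n S = map w [0..<n]"
    and D: "D \<in> in_channels m n" "in_field_address m n D = map w [n..<n + n]"
  shows "is_path m n S D (X, Y) \<longleftrightarrow>
    length X = n + 1 \<and> length Y = n \<and>
    (\<forall>k\<le>n. X ! k \<in> in_channels m n \<and> in_field_address m n (X ! k) = map w [k..<k + n]) \<and>
    (\<forall>k<n. Y ! k \<in> out_channels m n \<and>
      out_field_address m n (Y ! k) = rotate1 (map w [k..<k + n]))"
    (is "?path \<longleftrightarrow> ?windows")
proof
  assume path: ?path
  have X: "X ! k \<in> in_channels m n" if "k \<le> n" for k
    using path D(1) that by (cases "k = n") simp_all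
  have Y: "Y ! k \<in> out_channels m n" if "k < n" for k
    using path that by simp
  have rot: "out_field_address m n (Y ! k) = rotate1 (in_field_address m n (X ! k))"
    if "k < n" for k
    using path that X Y shuffle_connected_iff_rotate1[of "X ! k" m n "Y ! k"] by simp
  have slide: "butlast (in_field_address m n (X ! Suc k)) = tl (in_field_address m n (X ! k))"
    if "k < n" for k
    using path that X[of "Suc k"] Y[of k] rot[of k]
      twc_linked_iff_butlast[of "Y ! k" m n "X ! Suc k"] by (simp add: butlast_rotate1)
  have "in_field_address m n (X ! k) = map w [k..<k + n]" if "k \<le> n" for k
  proof (rule sliding_windows[where x = "\<lambda>k. in_field_address m n (X ! k)"])
    show "in_field_address m n (X ! 0) = map w [0..<n]"
      and "in_field_address m n (X ! n) = map w [n..<n + n]"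
      using path S(2) D(2) by simp_all
  qed (use n that slide in \<open>simp_all only: length_in_field_address\<close>)
  then show ?windows using path X Y rot by simp
next
  assume windows: ?windows
  note inj = bij_betw_imp_inj_on[OF bij_in_field_address[OF m n]]
  \<comment> \<open>Channels with equal field addresses coincide.\<close>
  have "X ! 0 = S" and "X ! n = D"
    using windows S D by (auto intro: inj_onD[OF inj])
  moreover have "shuffle_connected m (X ! k) (Y ! k)" if "k < n" for k
    using windows that shuffle_connected_iff_rotate1[of "X ! k" m n "Y ! k"] by simp
  moreover have "twc_linked m n (fst (Y ! k)) (fst (X ! Suc k))" if "k < n" for k
  proof -
    \<comment> \<open>Both sides are the overlap of two consecutive windows, at positions k + 1 to k
      + n - 1.\<close>
    have "butlast (map w [Suc k..<Suc k + n]) = tl (map w [k..<k + n])"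
      using n by (simp add: map_butlast[symmetric] map_tl[symmetric])
    then show ?thesis
      using windows that twc_linked_iff_butlast[of "Y ! k" m n "X ! Suc k"]
      by (simp add: butlast_rotate1 del: upt_Suc)
  qed
  ultimately show ?path
    using windows by (auto simp: net_out_channels_def)
qed

text \<open>Each entry is the unique preimage of a prescribed value, so the lists are determined
  entrywise.\<close>

lemma ex1_list_pair_preimage:
  assumes f: "bij_betw f A W" and g: "bij_betw g B V"
    and u: "\<And>k. k < a \<Longrightarrow> u k \<in> W" and v: "\<And>k. k < b \<Longrightarrow> v k \<in> V"
  shows "\<exists>!P. length (fst P) = a \<and> length (snd P) = b \<and>
    (\<forall>k<a. fst P ! k \<in> A \<and> f (fst P ! k) = u k) \<and>
    (\<forall>k<b. snd P ! k \<in> B \<and> g (snd P ! k) = v k)"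
    (is "\<exists>!P. ?Q P")
proof (rule ex_ex1I)
  let ?P = "(map (\<lambda>k. inv_into A f (u k)) [0..<a], map (\<lambda>k. inv_into B g (v k)) [0..<b])"
  have "?Q ?P"
    using u v f g by (auto simp: bij_betw_def inv_into_into f_inv_into_f)
  then show "\<exists>P. ?Q P" by blast
next
  fix P P' assume Q: "?Q P" "?Q P'"
  have "fst P ! k = fst P' ! k" if "k < a" for k
    using Q that by (intro inj_onD[OF bij_betw_imp_inj_on[OF f]]) simp_all
  moreover have "snd P ! k = snd P' ! k" if "k < b" for k
    using Q that by (intro inj_onD[OF bij_betw_imp_inj_on[OF g]]) simp_all
  ultimately show "P = P'"
    using Q by (simp add: prod_eq_iff list_eq_iff_nth_eq)
qed

theorem mainTheorem4:
  fixes m n :: nat and S D :: in_channel and s d :: "nat \<Rightarrow> nat"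
  assumes "m \<ge> 2" and "n \<ge> 2"
    and "S \<in> net_in_channels m n" and "in_field_address m n S = digits s n 1"
    and "D \<in> net_out_channels m n" and "in_field_address m n D = digits d n 1"
  shows "(\<exists>!P. is_path m n S D P) \<and>
    (\<forall>X Y. is_path m n S D (X, Y) \<longrightarrow>
      (\<forall>k<n.
        in_field_address m n (X ! k) = digits s (n - k) 1 @ digits d n (n - k + 1) \<and>
        out_field_address m n (Y ! k) =
          digits s (n - k - 1) 1 @ digits d n (n - k + 1) @ [s (n - k)]) \<and>
      snd (X ! 0) = (s n + s 1) mod m \<and> snd (Y ! 0) = (s n + s 1) mod m \<and>
      (\<forall>k\<in>{1..n - 1}.
        snd (X ! k) = (s (n - k) + d (n - k + 1)) mod m \<and>
        snd (Y ! k) = (s (n - k) + d (n - k + 1)) mod m) \<and>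
      snd (X ! n) = (d n + d 1) mod m)"
proof -
  define w where "w = route n s d"
  have m: "0 < m" using assms(1) by simp
  note n = assms(2)
  have S: "S \<in> in_channels m n" "in_field_address m n S = map w [0..<n]"
    using assms(3,4) route_window[of 0 n s d]
    by (simp_all add: w_def net_in_channels_def digits_def)
  have D: "D \<in> in_channels m n" "in_field_address m n D = map w [n..<n + n]"
    using assms(5,6) route_window[of n n s d]
    by (simp_all add: w_def net_out_channels_def digits_def)
  note path_iff = is_path_iff_windows[OF m n S D]
  note bij_in = bij_in_field_address[OF m n]
  have "map w [0..<n] \<in> words m n" "map w [n..<n + n] \<in> words m n"
    using bij_betw_apply[OF bij_in S(1)] bij_betw_apply[OF bij_in D(1)] S(2) D(2) by simp_all
  \<comment> \<open>Every letter of the route string occurs in the field address of S or D, and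
    these are words over the digits below \<open>m\<close>.\<close>
  then have "w t < m" if "t < n + n" for t
    using that by (cases "t < n") (auto simp: words_def image_subset_iff)
  then have window: "map w [k..<k + n] \<in> words m n" if "k \<le> n" for k
    using that by (auto simp: words_def)
  have "\<exists>!P. is_path m n S D P"
  proof -
    have "is_path m n S D P \<longleftrightarrow>
        length (fst P) = n + 1 \<and> length (snd P) = n \<and>
        (\<forall>k<n + 1. fst P ! k \<in> in_channels m n \<and>
          in_field_address m n (fst P ! k) = map w [k..<k + n]) \<and>
        (\<forall>k<n. snd P ! k \<in> out_channels m n \<and>
          out_field_address m n (snd P ! k) = rotate1 (map w [k..<k + n]))" for P
      using path_iff[of "fst P" "snd P"] by (simp add: less_Suc_eq_le)
    moreover have "rotate1 (map w [k..<k + n]) \<in> words m n" if "k < n" for k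
      using window[of k] that by (simp add: words_def)
    ultimately show ?thesis
      using ex1_list_pair_preimage[OF bij_in bij_out_field_address[OF m n],
          of "n + 1" "\<lambda>k. map w [k..<k + n]" n "\<lambda>k. rotate1 (map w [k..<k + n])"] window
      by simp
  qed
  moreover have "(\<forall>k<n.
        in_field_address m n (X ! k) = digits s (n - k) 1 @ digits d n (n - k + 1) \<and>
        out_field_address m n (Y ! k) =
          digits s (n - k - 1) 1 @ digits d n (n - k + 1) @ [s (n - k)]) \<and>
      snd (X ! 0) = (s n + s 1) mod m \<and> snd (Y ! 0) = (s n + s 1) mod m \<and>
      (\<forall>k\<in>{1..n - 1}.
        snd (X ! k) = (s (n - k) + d (n - k + 1)) mod m \<and>
        snd (Y ! k) = (s (n - k) + d (n - k + 1)) mod m) \<and>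
      snd (X ! n) = (d n + d 1) mod m"
    if path: "is_path m n S D (X, Y)" for X Y
  proof -
    note windows = path[unfolded path_iff]
    have X: "snd (X ! k) = (w k + w (k + n - 1)) mod m" if "k \<le> n" for k
      using windows that n wavelength_in_channel[of "X ! k" m n]
      by (simp add: hd_map last_map)
    have Y: "snd (Y ! k) = snd (X ! k)" if "k < n" for k
    proof -
      have "shuffle_connected m (X ! k) (Y ! k)" using path that by simp
      then show ?thesis by (cases "(m, X ! k, Y ! k)" rule: shuffle_connected.cases) simp
    qed
    \<comment> \<open>\<open>digits_Cons\<close> exposes the leading digit of the window, which
      \<open>rotate1\<close> moves to the end.\<close>
    have addr: "in_field_address m n (X ! k) = digits s (n - k) 1 @ digits d n (n - k + 1)"
        "out_field_address m n (Y ! k) =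
          digits s (n - k - 1) 1 @ digits d n (n - k + 1) @ [s (n - k)]" if "k < n" for k
      using windows that route_window[of k n s d] digits_Cons[of 1 "n - k" s]
      by (simp_all add: w_def)
    have ends: "w 0 = s n" "w (n - 1) = s 1" "w n = d n" "w (n + n - 1) = d 1"
      using n by (auto simp: w_def route_def mult_2)
    \<comment> \<open>For k at least 1 the last position k + n - 1 of the window lies in the half of
      D; for k = 0 it still lies in that of S, hence the separate formula for stage 0.\<close>
    have mid: "w k = s (n - k) \<and> w (k + n - 1) = d (n - k + 1)" if "k \<in> {1..n - 1}" for k
    proof -
      have "2 * n - (k + n - 1) = n - k + 1" "\<not> k + n - 1 < n" "k < n"
        using that by auto
      then show ?thesis by (simp add: w_def route_def)
    qed
    show ?thesis
      using addr X Y ends mid n by (intro conjI allI impI ballI) auto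
  qed
  ultimately show ?thesis by blast
qed

end
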